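(* Let $D_0>0$, $R\ge e^{e/(e-1)}$, and let $\mathbf x_0\in\mathbb C^d$ satisfy $1\le\|\mathbf x_0\|_\infty<e^{-1}\ln R$. Define $$T_C^*=\frac{(e-1)(\ln R)^2}{(2e-1)D_0R}\ln\Big(\frac{\ln R}{e\|\mathbf x_0\|_\infty}\Big),\qquad r_C(t)=e^{D_0Rt/(\ln R)^2}\Big(\frac{e\|\mathbf x_0\|_\infty}{\ln R}\Big)^{(e-1)/(2e-1)},$$ and, with $E_0=\max\{\|\exp(i\mathbf x_0)\|_\infty,\|\exp(-i\mathbf x_0)\|_\infty\}$, $$\tilde T_{CF}^*=\frac{e-1}{2D_0(2e-1)}\big(\ln R-1-\ln E_0\big),\qquad\tilde r_{CF}(t)=e^{2D_0t}\Big(\frac{eE_0}{R}\Big)^{(e-1)/(2e-1)} .$$ Then $$T_C^*\le\tilde T_{CF}^*\qquad\text{and}\qquad\tilde r_{CF}(t)\le r_C(t)\ \text{ for all }0\le t\le T_C^* .$$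
   Context: $\exp(\pm i\mathbf x_0)$ is taken componentwise and $\|\cdot\|_\infty$ is the max norm on $\mathbb C^d$. (The quantities $T_C^*$, $r_C$ and $\tilde T_{CF}^*$, $\tilde r_{CF}$ are the convergence time ranges and convergence rates of finite-section approximations of the Carleman and Carleman-Fourier linearizations, respectively; only the displayed formulas are needed.) *)

theory Defs
  imports "HOL-Analysis.Analysis"
begin

(* The library's infnorm is not suitable here: on complex ^ 'd it is the maximum over the
   real and imaginary parts of the components, not over their moduli. *)
definition max_norm :: "complex ^ 'd \<Rightarrow> real" where
  "max_norm x = Max (range (\<lambda>j. cmod (x $ j)))"

definition exp_vec :: "complex ^ 'd \<Rightarrow> complex ^ 'd" where
  "exp_vec x = (\<chi> j. exp (x $ j))"

definition T_C :: "real \<Rightarrow> real \<Rightarrow> complex ^ 'd \<Rightarrow> real" where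
  "T_C D0 R x0 =
     (exp 1 - 1) * (ln R)\<^sup>2 / ((2 * exp 1 - 1) * D0 * R) * ln (ln R / (exp 1 * max_norm x0))"

definition r_C :: "real \<Rightarrow> real \<Rightarrow> complex ^ 'd \<Rightarrow> real \<Rightarrow> real" where
  "r_C D0 R x0 t =
     exp (D0 * R * t / (ln R)\<^sup>2)
       * (exp 1 * max_norm x0 / ln R) powr ((exp 1 - 1) / (2 * exp 1 - 1))"

definition E_0 :: "complex ^ 'd \<Rightarrow> real" where
  "E_0 x0 = max (max_norm (exp_vec (\<i> *s x0))) (max_norm (exp_vec (- (\<i> *s x0))))"

definition T_CF :: "real \<Rightarrow> real \<Rightarrow> complex ^ 'd \<Rightarrow> real" where
  "T_CF D0 R x0 = (exp 1 - 1) / (2 * D0 * (2 * exp 1 - 1)) * (ln R - 1 - ln (E_0 x0))"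

definition r_CF :: "real \<Rightarrow> real \<Rightarrow> complex ^ 'd \<Rightarrow> real \<Rightarrow> real" where
  "r_CF D0 R x0 t =
     exp (2 * D0 * t) * (exp 1 * E_0 x0 / R) powr ((exp 1 - 1) / (2 * exp 1 - 1))"

end

theory Submission
  imports Defs
begin

text \<open>
  Write \<open>L = ln R\<close> and \<open>m\<close> for the max norm of \<open>x0\<close>; the hypotheses give
  \<open>exp 1 \<le> exp 1 * m < L\<close>. Everything reduces to two real inequalities. The first,
  \<open>2 * L\<^sup>2 \<le> R\<close> (lemma \<open>two_power2_le_exp\<close>), compares the time scales \<open>L\<^sup>2 / R\<close> and
  \<open>1 / 2\<close> in the two time ranges, and equally the growth exponents \<open>R / L\<^sup>2\<close> and \<open>2\<close> in the
  two rates. The second, \<open>ln (L / (exp 1 * m)) \<le> L - 1 - ln E_0\<close> (lemma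
  \<open>ln_ratio_le_log_gap\<close>), compares the remaining logarithmic factors. It rests on
  \<open>ln E_0 \<le> m\<close>, which holds because the modulus of \<open>exp z\<close> is at most
  \<open>exp (cmod z)\<close>, and on the fact that \<open>x - ln x\<close> increases for \<open>x \<ge> 1\<close>.
  Up to a common positive factor, each time range is the product of its time scale and its
  logarithmic factor. Each rate is the product of a growth factor,
  ordered by the first inequality, and a power, whose base is ordered by the second.
\<close>

lemma cmod_component_le_max_norm: "cmod (x $ j) \<le> max_norm x"
  unfolding max_norm_def by (rule Max_ge) auto

lemma max_norm_exp_vec_le:
  assumes "max_norm x \<le> B"
  shows "max_norm (exp_vec x) \<le> exp B"
proof -
  have "cmod (exp (x $ j)) \<le> exp B" for j
  proof -
    have "cmod (exp (x $ j)) \<le> exp (cmod (x $ j))"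
      by (rule norm_exp)
    also have "\<dots> \<le> exp B"
      using cmod_component_le_max_norm[of x j] assms by simp
    finally show ?thesis .
  qed
  then show ?thesis
    unfolding max_norm_def exp_vec_def by simp
qed

lemma max_norm_exp_vec_pos: "0 < max_norm (exp_vec x)"
proof -
  have "0 < cmod (exp_vec x $ undefined)"
    by (simp add: exp_vec_def)
  also have "\<dots> \<le> max_norm (exp_vec x)"
    by (rule cmod_component_le_max_norm)
  finally show ?thesis .
qed

lemma E_0_pos: "0 < E_0 x0"
  unfolding E_0_def by (simp add: less_max_iff_disj max_norm_exp_vec_pos)

lemma ln_E_0_le_max_norm: "ln (E_0 x0) \<le> max_norm x0"
proof -
  have "max_norm (\<i> *s x0) = max_norm x0" "max_norm (- (\<i> *s x0)) = max_norm x0"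
    by (simp_all add: max_norm_def norm_mult)
  then have "E_0 x0 \<le> exp (max_norm x0)"
    unfolding E_0_def by (simp add: max_norm_exp_vec_le)
  then show ?thesis
    using E_0_pos[of x0] by (subst exp_le_cancel_iff[symmetric]) simp
qed

text \<open>
  Concavity of the logarithm gives \<open>ln L \<le> L / exp 1\<close>, the tangent at \<open>exp 1\<close>. Hence
  \<open>L - 2 * ln L \<ge> L * (1 - 2 / exp 1) \<ge> exp 1 - 2\<close>, and this exceeds \<open>ln 2\<close>. The margin
  is only about \<open>0.025\<close>, whence the decimal bounds on \<open>exp 1\<close> and \<open>ln 2\<close>.
\<close>
lemma two_power2_le_exp:
  fixes L :: real
  assumes "exp 1 \<le> L"
  shows "2 * L\<^sup>2 \<le> exp L"
proof -
  have L: "0 < L"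
    using assms exp_gt_zero[of "1::real"] by linarith
  have e: "exp 1 \<ge> (27 / 10 :: real)"
    using e_approx_32 unfolding abs_le_iff by simp
  have "ln (L / exp 1) \<le> L / exp 1 - 1"
    using L by (intro ln_le_minus_one) simp
  then have tangent: "ln L \<le> L / exp 1"
    using L by (simp add: ln_div)
  have "exp 1 - 2 = exp 1 * (1 - 2 / exp (1::real))"
    by (simp add: field_simps)
  also have "\<dots> \<le> L * (1 - 2 / exp 1)"
    using assms e by (intro mult_right_mono) (simp_all add: field_simps)
  also have "\<dots> = L - 2 * (L / exp 1)"
    by (simp add: algebra_simps)
  finally have "ln 2 + 2 * ln L \<le> L"
    using tangent e ln2_le_25_over_36 by linarith
  then have "ln (2 * L\<^sup>2) \<le> L"
    using L by (simp add: ln_mult ln_realpow)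
  then show ?thesis
    using L by (subst (asm) exp_le_cancel_iff[symmetric]) simp
qed

text \<open>
  The extreme case \<open>a = m\<close> says that \<open>m - ln m \<le> L - ln L\<close>: the mean slope of \<open>ln\<close> on the
  interval from \<open>m\<close> to \<open>L\<close> is at most \<open>1 / m \<le> 1\<close>.
\<close>
lemma ln_ratio_le_log_gap:
  fixes L m a :: real
  assumes "1 \<le> m" "m \<le> L" "a \<le> m"
  shows "ln (L / (exp 1 * m)) \<le> L - 1 - a"
proof -
  have "ln (L / m) \<le> L / m - 1"
    using assms by (intro ln_le_minus_one) simp
  also have "\<dots> = (L - m) / m"
    using assms by (simp add: field_simps)
  also have "\<dots> \<le> L - m"
    using assms by (simp add: divide_le_eq mult_left_mono[of 1 m "L - m", simplified])
  finally have "ln (L / m) \<le> L - m" .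
  then show ?thesis
    using assms by (simp add: ln_div ln_mult)
qed

theorem mainTheorem8:
  fixes D0 R :: real and x0 :: "complex ^ 'd"
  assumes "D0 > 0"
    and "R \<ge> exp (exp 1 / (exp 1 - 1))"
    and "1 \<le> max_norm x0"
    and "max_norm x0 < exp (- 1) * ln R"
  shows "T_C D0 R x0 \<le> T_CF D0 R x0
    \<and> (\<forall>t::real. 0 \<le> t \<and> t \<le> T_C D0 R x0 \<longrightarrow> r_CF D0 R x0 t \<le> r_C D0 R x0 t)"
proof -
  define L m \<alpha> :: real where "L = ln R" and "m = max_norm x0"
    and "\<alpha> = (exp 1 - 1) / (2 * exp 1 - 1)"
  have m: "1 \<le> m"
    using assms(3) by (simp add: m_def)
  have e: "(1::real) < exp 1"
    by simp
  have "0 < \<alpha>"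
    unfolding \<alpha>_def using e by (intro divide_pos_pos) linarith+
  have "0 < R"
    using assms(2) exp_gt_zero less_le_trans by blast
  then have R: "R = exp L"
    by (simp add: L_def)
  have emL: "exp 1 * m < L"
    using assms(4) by (simp add: m_def L_def exp_minus field_simps)
  have eL: "exp 1 \<le> L"
    proof -
    have "exp 1 * 1 \<le> exp 1 * m"
      using m by (intro mult_left_mono) simp_all
    with emL show ?thesis
      by linarith
  qed
  have mL: "m \<le> L"
    proof -
    have "1 * m \<le> exp 1 * m"
      using m by (intro mult_right_mono) simp_all
    with emL show ?thesis
      by linarith
  qed
  have L: "0 < L"
    using m mL by linarith
  have scale: "2 * L\<^sup>2 \<le> R"
    unfolding R using eL by (rule two_power2_le_exp)
  have gap: "ln (L / (exp 1 * m)) \<le> L - 1 - ln (E_0 x0)"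
    using m mL ln_E_0_le_max_norm[of x0] by (intro ln_ratio_le_log_gap) (simp_all add: m_def)
  have gap_nonneg: "0 \<le> ln (L / (exp 1 * m))"
    using emL m by (intro ln_ge_zero) (simp add: field_simps)

  have "T_C D0 R x0 = \<alpha> / D0 * (L\<^sup>2 / R * ln (L / (exp 1 * m)))"
    by (simp add: T_C_def \<alpha>_def L_def m_def)
  also have "\<dots> \<le> \<alpha> / D0 * (1 / 2 * (L - 1 - ln (E_0 x0)))"
  proof (intro mult_left_mono mult_mono)
    show "L\<^sup>2 / R \<le> 1 / 2"
      using scale \<open>0 < R\<close> by (simp add: field_simps)
  qed (use gap gap_nonneg \<open>0 < \<alpha>\<close> assms(1) in auto)
  also have "\<dots> = T_CF D0 R x0"
    by (simp add: T_CF_def \<alpha>_def L_def)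
  finally have times: "T_C D0 R x0 \<le> T_CF D0 R x0" .

  have rates: "r_CF D0 R x0 t \<le> r_C D0 R x0 t" if "0 \<le> t" for t
  proof -
    have "2 * (D0 * t) \<le> R / L\<^sup>2 * (D0 * t)"
      using scale L that assms(1) by (intro mult_right_mono) (simp_all add: field_simps)
    then have growth: "exp (2 * D0 * t) \<le> exp (D0 * R * t / L\<^sup>2)"
      by (simp add: algebra_simps)
    have "ln (exp 1 * E_0 x0 / R) \<le> ln (exp 1 * m / L)"
      using gap m L E_0_pos[of x0] by (simp add: R ln_div ln_mult)
    then have "exp 1 * E_0 x0 / R \<le> exp 1 * m / L"
      using m L E_0_pos[of x0] \<open>0 < R\<close> by (subst (asm) ln_le_cancel_iff) simp_all
    then have "(exp 1 * E_0 x0 / R) powr \<alpha> \<le> (exp 1 * m / L) powr \<alpha>"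
      using \<open>0 < \<alpha>\<close> E_0_pos[of x0] \<open>0 < R\<close> by (intro powr_mono2) simp_all
    with growth show ?thesis
      unfolding r_CF_def r_C_def L_def m_def \<alpha>_def by (intro mult_mono) simp_all
  qed
  from times rates show ?thesis
    by blast
qed

end
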